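(* Let $G$ be a finitely quasihamiltonian locally finite group. Then for every endomorphism $\phi$ of $G$ and every $\phi$-invariant normal subgroup $H$ of $G$ one has $$h(\phi)=h(\phi\restriction_H)+h(\bar\phi_{G/H}),$$ where $\phi\restriction_H\in\mathrm{End}(H)$ is the restriction of $\phi$ to $H$ and $\bar\phi_{G/H}\in\mathrm{End}(G/H)$ is the endomorphism induced by $\phi$.
   Context: For a group $G$, let $\mathcal P_{fin}(G)$ be the set of all finite non-empty subsets of $G$ and $\mathcal F(G)$ the set of all finite subgroups of $G$. Products of subsets are setwise: $XY=\{xy\mid x\in X,\ y\in Y\}$. Put $\mathcal F_C(G)=\{F\in\mathcal F(G)\mid FE=EF\text{ for all }E\in\mathcal F(G)\}$. The group $G$ is called finitely quasihamiltonian if $\mathcal F_C(G)$ is cofinal in $\mathcal F(G)$ with respect to inclusion, i.e. every finite subgroup of $G$ is contained in some member of $\mathcal F_C(G)$. A group is locally finite if each of its finitely generated subgroups is finite. Algebraic entropy: for a group $G$, $\phi\in\mathrm{End}(G)$ and $X\in\mathcal P_{fin}(G)$, let $T_0(\phi,X)=\{1\}$ and $T_n(\phi,X)=X\phi(X)\phi^2(X)\cdots\phi^{n-1}(X)$ for $n\geq 1$. The limit $H(\phi,X)=\lim_{n\to\infty}\frac{\log|T_n(\phi,X)|}{n}$ exists and is finite. The algebraic entropy of $\phi$ is $h(\phi)=\sup\{H(\phi,X)\mid X\in\mathcal P_{fin}(G)\}\in[0,\infty]$ (with the usual convention $a+\infty=\infty$ for sums in $[0,\infty]$). A subgroup $H$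 of $G$ is $\phi$-invariant if $\phi(H)\subseteq H$. *)

theory Defs
  imports "HOL-Algebra.Coset" "HOL-Algebra.Generated_Groups" "HOL-Library.Extended_Real"
begin

definition finite_subgroups :: "('a, 'b) monoid_scheme \<Rightarrow> 'a set set" where
  "finite_subgroups G = {F. subgroup F G \<and> finite F}"

definition permutable_finite_subgroups :: "('a, 'b) monoid_scheme \<Rightarrow> 'a set set" where
  "permutable_finite_subgroups G =
     {F \<in> finite_subgroups G. \<forall>E \<in> finite_subgroups G. F <#>\<^bsub>G\<^esub> E = E <#>\<^bsub>G\<^esub> F}"

definition finitely_quasihamiltonian :: "('a, 'b) monoid_scheme \<Rightarrow> bool" where
  "finitely_quasihamiltonian G \<longleftrightarrow>
     (\<forall>E \<in> finite_subgroups G. \<exists>F \<in> permutable_finite_subgroups G. E \<subseteq> F)"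

definition locally_finite_group :: "('a, 'b) monoid_scheme \<Rightarrow> bool" where
  "locally_finite_group G \<longleftrightarrow>
     (\<forall>X. X \<subseteq> carrier G \<and> finite X \<longrightarrow> finite (generate G X))"

definition finite_nonempty_subsets :: "('a, 'b) monoid_scheme \<Rightarrow> 'a set set" where
  "finite_nonempty_subsets G = {X. X \<subseteq> carrier G \<and> finite X \<and> X \<noteq> {}}"

text \<open>The trajectory $X \phi(X) \cdots \phi^{n-1}(X)$, with left-associated setwise products.\<close>

primrec trajectory :: "('a, 'b) monoid_scheme \<Rightarrow> ('a \<Rightarrow> 'a) \<Rightarrow> 'a set \<Rightarrow> nat \<Rightarrow> 'a set" where
  "trajectory G \<phi> X 0 = {\<one>\<^bsub>G\<^esub>}"
| "trajectory G \<phi> X (Suc n) = trajectory G \<phi> X n <#>\<^bsub>G\<^esub> (\<phi> ^^ n) ` X"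

text \<open>The limit below exists whenever \<open>\<phi>\<close> is an endomorphism of the group \<open>G\<close> and \<open>X\<close> is a
  finite non-empty subset of \<open>G\<close>, because the sequence of logarithms is subadditive.\<close>

definition entropy_wrt :: "('a, 'b) monoid_scheme \<Rightarrow> ('a \<Rightarrow> 'a) \<Rightarrow> 'a set \<Rightarrow> real" where
  "entropy_wrt G \<phi> X = lim (\<lambda>n. ln (real (card (trajectory G \<phi> X n))) / real n)"

definition algebraic_entropy :: "('a, 'b) monoid_scheme \<Rightarrow> ('a \<Rightarrow> 'a) \<Rightarrow> ereal" where
  "algebraic_entropy G \<phi> = (SUP X \<in> finite_nonempty_subsets G. ereal (entropy_wrt G \<phi> X))"

text \<open>The map on cosets that sends $Hx$ to $H\phi(x)$, written without choosing a representative;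
  see \<open>induced_endo_coset\<close>.\<close>

definition induced_endo :: "('a, 'b) monoid_scheme \<Rightarrow> 'a set \<Rightarrow> ('a \<Rightarrow> 'a) \<Rightarrow> 'a set \<Rightarrow> 'a set" where
  "induced_endo G H \<phi> C = (\<Union>x\<in>C. H #>\<^bsub>G\<^esub> \<phi> x)"

lemma induced_endo_coset:
  assumes "H \<lhd> G" "\<phi> \<in> hom G G" "\<phi> ` H \<subseteq> H" "x \<in> carrier G"
  shows "induced_endo G H \<phi> (H #>\<^bsub>G\<^esub> x) = H #>\<^bsub>G\<^esub> \<phi> x"
proof -
  interpret normal H G by fact
  have fx: "\<phi> x \<in> carrier G"
    using assms by (auto simp: hom_def)
  have "H #>\<^bsub>G\<^esub> \<phi> y = H #>\<^bsub>G\<^esub> \<phi> x" if y: "y \<in> H #>\<^bsub>G\<^esub> x" for y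
  proof -
    obtain h where h: "h \<in> H" "y = h \<otimes>\<^bsub>G\<^esub> x"
      using y by (auto simp: r_coset_def)
    then have "\<phi> y = \<phi> h \<otimes>\<^bsub>G\<^esub> \<phi> x" "\<phi> h \<in> H"
      using assms by (auto simp: hom_mult)
    then have "\<phi> y \<in> H #>\<^bsub>G\<^esub> \<phi> x"
      by (auto simp: r_coset_def)
    then show ?thesis
      using repr_independence fx is_subgroup by metis
  qed
  moreover have "x \<in> H #>\<^bsub>G\<^esub> x"
    using assms(4) by (rule rcos_self) (rule is_subgroup)
  ultimately show ?thesis
    unfolding induced_endo_def by blast
qed

lemma induced_endo_hom:
  assumes "H \<lhd> G" "\<phi> \<in> hom G G" "\<phi> ` H \<subseteq> H"
  shows "induced_endo G H \<phi> \<in> hom (G Mod H) (G Mod H)"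
proof -
  interpret normal H G by fact
  show ?thesis
  proof (rule homI)
    fix C assume "C \<in> carrier (G Mod H)"
    then obtain x where "x \<in> carrier G" "C = H #>\<^bsub>G\<^esub> x"
      by (auto simp: FactGroup_def RCOSETS_def)
    then show "induced_endo G H \<phi> C \<in> carrier (G Mod H)"
      using assms hom_in_carrier[OF assms(2)]
      by (auto simp: induced_endo_coset FactGroup_def RCOSETS_def)
  next
    fix C D assume "C \<in> carrier (G Mod H)" "D \<in> carrier (G Mod H)"
    then obtain x y where "x \<in> carrier G" "C = H #>\<^bsub>G\<^esub> x" "y \<in> carrier G" "D = H #>\<^bsub>G\<^esub> y"
      by (auto simp: FactGroup_def RCOSETS_def)
    then show "induced_endo G H \<phi> (C \<otimes>\<^bsub>G Mod H\<^esub> D)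
        = induced_endo G H \<phi> C \<otimes>\<^bsub>G Mod H\<^esub> induced_endo G H \<phi> D"
      using assms hom_in_carrier[OF assms(2)]
      by (simp add: induced_endo_coset rcos_sum hom_mult)
  qed
qed

end

theory Submission
  imports Defs
begin

text \<open>Let \<open>F\<close> be a finite permutable subgroup, \<open>T\<^sub>n\<close> its trajectories and \<open>D\<^sub>n = T\<^sub>n \<inter> H\<close>. Permutability makes every
  \<open>T\<^sub>n\<close> a subgroup, so \<open>|T\<^sub>n|\<close> is \<open>|D\<^sub>n|\<close> times the size of the image of \<open>T\<^sub>n\<close> in \<open>G/H\<close>, which is a
  trajectory of the quotient; since \<open>D\<^sub>n\<close> contains the trajectories of the subsets of \<open>F \<inter> H\<close>,
  the inequality \<open>\<ge>\<close> follows.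

  For \<open>\<le>\<close>, the set of all \<open>f \<in> F\<close> with \<open>\<phi>\<^sup>n(f) \<in> T\<^sub>n H\<close> increases with \<open>n\<close> and is therefore constant
  from some \<open>m\<close> on. The last factor \<open>\<phi>\<^sup>m\<^sup>+\<^sup>k(f)\<close> of an element of \<open>D\<^sub>m\<^sub>+\<^sub>k\<^sub>+\<^sub>1\<close> can then be replaced by an element of
  \<open>\<phi>\<^sup>k(D\<^sub>m\<^sub>+\<^sub>1)\<close>, which puts \<open>D\<^sub>m\<^sub>+\<^sub>k\<close> inside the product of \<open>D\<^sub>m\<close> and the \<open>k\<close>-th trajectory of \<open>D\<^sub>m\<^sub>+\<^sub>1\<close>.\<close>

section \<open>Subadditive real sequences\<close>

lemma subadditive_mult_bound:
  fixes a :: "nat \<Rightarrow> real"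
  assumes "\<And>m n. a (m + n) \<le> a m + a n"
  shows "a (q * m + r) \<le> real q * a m + a r"
proof (induction q)
  case (Suc q)
  have "a (Suc q * m + r) \<le> a m + a (q * m + r)"
    using assms[of m "q * m + r"] by (simp add: add.assoc)
  with Suc show ?case
    by (simp add: algebra_simps)
qed simp

text \<open>The limit is the infimum of the quotients. Choose \<open>m\<close> with quotient close
  to it and divide \<open>n\<close> by \<open>m\<close>: the full blocks cost at most
  \<open>n * (a m / m)\<close>, and the remainder costs a constant independent of
  \<open>n\<close>.\<close>

lemma fekete:
  fixes a :: "nat \<Rightarrow> real"
  assumes sub: "\<And>m n. a (m + n) \<le> a m + a n" and nonneg: "\<And>n. 0 \<le> a n"
  shows "convergent (\<lambda>n. a n / real n)"
proof -
  \<comment> \<open>Index 0 is left out because \<open>a 0 / real 0\<close> is 0 and would spoil the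
    infimum.\<close>
  define L where "L = (INF n\<in>{1..}. a n / real n)"
  have bdd: "bdd_below ((\<lambda>n. a n / real n) ` {1..})"
    using nonneg by (intro bdd_belowI[of _ 0]) auto
  have lower: "L \<le> a n / real n" if "n \<ge> 1" for n
    unfolding L_def using that by (intro cINF_lower bdd) auto
  have "(\<lambda>n. a n / real n) \<longlonglongrightarrow> L"
  proof (rule LIMSEQ_I)
    fix e :: real assume "0 < e"
    then have "L < L + e / 2" by simp
    then obtain m where m: "m \<ge> 1" "a m / real m < L + e / 2"
      unfolding L_def by (subst (asm) cINF_less_iff) (use bdd in auto)
    \<comment> \<open>A bound for all possible remainder terms \<open>a (n mod m)\<close>;
      \<open>N\<close> is then chosen so that it contributes less than \<open>e / 2\<close> after
      division by \<open>n\<close>.\<close>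
    define C where "C = (\<Sum>r<m. a r)"
    obtain N where N: "real N > 2 * C / e"
      using reals_Archimedean2 by blast
    show "\<exists>no. \<forall>n\<ge>no. norm (a n / real n - L) < e"
    proof (intro exI allI impI)
      fix n assume n: "n \<ge> Suc N"
      have "a (n mod m) \<le> C"
        unfolding C_def using m nonneg by (intro member_le_sum) auto
      moreover have "a n \<le> real (n div m) * a m + a (n mod m)"
        using subadditive_mult_bound[of a "n div m" m "n mod m", OF sub] by simp
      moreover have "real (n div m) * a m \<le> real n * (a m / real m)"
      proof -
        have "real (n div m) * real m \<le> real n"
          by (metis div_times_less_eq_dividend of_nat_le_iff of_nat_mult)
        then have "real (n div m) \<le> real n / real m"
          using m by (simp add: field_simps)
        from mult_right_mono[OF this nonneg[of m]] show ?thesis by simp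
      qed
      moreover have "real n * (a m / real m) \<le> real n * (L + e / 2)"
        using m by (intro mult_left_mono) auto
      moreover have "C < real n * (e / 2)"
      proof -
        have "2 * C / e < real n" using N n by linarith
        with \<open>0 < e\<close> show ?thesis by (simp add: field_simps)
      qed
      ultimately have "a n < real n * (L + e)"
        by (simp add: algebra_simps)
      then have "a n / real n < L + e"
        using n by (simp add: field_simps)
      with lower[of n] n show "norm (a n / real n - L) < e"
        by simp
    qed
  qed
  then show ?thesis by (rule convergentI)
qed

section \<open>Setwise products and counting cosets\<close>

lemma set_multI: "x \<in> A \<Longrightarrow> y \<in> B \<Longrightarrow> x \<otimes>\<^bsub>G\<^esub> y \<in> A <#>\<^bsub>G\<^esub> B"
  by (auto simp: set_mult_def)

lemma set_multE:
  assumes "z \<in> A <#>\<^bsub>G\<^esub> B"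
  obtains x y where "x \<in> A" "y \<in> B" "z = x \<otimes>\<^bsub>G\<^esub> y"
  using assms by (auto simp: set_mult_def)

lemma set_mult_eq_image: "A <#>\<^bsub>G\<^esub> B = (\<lambda>(x, y). x \<otimes>\<^bsub>G\<^esub> y) ` (A \<times> B)"
  by (auto simp: set_mult_def)

lemma finite_set_mult: "finite A \<Longrightarrow> finite B \<Longrightarrow> finite (A <#>\<^bsub>G\<^esub> B)"
  by (simp add: set_mult_eq_image)

lemma card_set_mult_le:
  assumes "finite A" "finite B"
  shows "card (A <#>\<^bsub>G\<^esub> B) \<le> card A * card B"
  unfolding set_mult_eq_image card_cartesian_product[symmetric]
  using assms by (intro card_image_le) simp

lemma (in group) subgroup_set_mult_commute:
  assumes A: "subgroup A G" and B: "subgroup B G" and comm: "A <#> B = B <#> A"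
  shows "subgroup (A <#> B) G"
proof (rule subgroupI)
  note sub = subgroup.subset[OF A] subgroup.subset[OF B]
  show "A <#> B \<subseteq> carrier G"
    by (rule setmult_subset_G) (rule sub)+
  show "A <#> B \<noteq> {}"
    using set_multI[OF subgroup.one_closed[OF A] subgroup.one_closed[OF B]] by blast
  show "inv x \<in> A <#> B" if x: "x \<in> A <#> B" for x
  proof -
    obtain a b where ab: "a \<in> A" "b \<in> B" "x = a \<otimes> b"
      using x by (rule set_multE)
    then have "inv x = inv b \<otimes> inv a"
      using sub by (simp add: inv_mult_group subset_iff)
    moreover have "inv b \<otimes> inv a \<in> B <#> A"
      using ab A B by (intro set_multI) (auto intro: subgroup.m_inv_closed)
    ultimately show ?thesis
      using comm by simp
  qed
  show "x \<otimes> y \<in> A <#> B" if "x \<in> A <#> B" "y \<in> A <#> B" for x y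
  proof -
    have "x \<otimes> y \<in> (A <#> B) <#> (A <#> B)"
      using that by (rule set_multI)
    also have "\<dots> = A <#> (B <#> A) <#> B"
      using sub by (simp add: set_mult_assoc setmult_subset_G)
    also have "\<dots> = (A <#> A) <#> (B <#> B)"
      unfolding comm[symmetric] using sub by (simp add: set_mult_assoc setmult_subset_G)
    also have "\<dots> = A <#> B"
      by (simp add: subgroup_mult_id A B)
    finally show ?thesis .
  qed
qed

text \<open>The fibres of the coset map on \<open>T\<close> are the sets
  \<open>T \<inter> (H #> x)\<close> with \<open>x \<in> T\<close>. They partition \<open>T\<close>,
  and each is the translate of \<open>T \<inter> H\<close> by \<open>x\<close>.\<close>

lemma (in normal) card_Int_mult_card_cosets:
  assumes T: "subgroup T G" and fin: "finite T"
  shows "card (T \<inter> H) * card ((\<lambda>x. H #> x) ` T) = card T"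
proof -
  let ?fib = "\<lambda>x. T \<inter> (H #> x)"
  note TG = subgroup.subset[OF T]
  have union: "\<Union> (?fib ` T) = T"
    using rcos_self[OF _ is_subgroup] TG by blast
  \<comment> \<open>A coset that meets \<open>T\<close> is determined by its trace on
    \<open>T\<close>, so there are as many fibres as cosets.\<close>
  have "inj_on (\<lambda>C. T \<inter> C) ((\<lambda>x. H #> x) ` T)"
  proof (rule inj_onI; clarify)
    fix x y assume xy: "x \<in> T" "y \<in> T" "T \<inter> (H #> x) = T \<inter> (H #> y)"
    then have "x \<in> H #> y"
      using rcos_self[OF _ is_subgroup] TG by blast
    then show "H #> x = H #> y"
      using repr_independence[OF _ _ is_subgroup, of x y] xy TG by auto
  qed
  then have card_fib: "card (?fib ` T) = card ((\<lambda>x. H #> x) ` T)"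
    by (metis card_image image_image)
  have "card (T \<inter> H) * card (?fib ` T) = card (\<Union> (?fib ` T))"
  proof (rule card_partition)
    show "finite (?fib ` T)" "finite (\<Union> (?fib ` T))"
      using fin by (auto simp: union)
    show "card c = card (T \<inter> H)" if c: "c \<in> ?fib ` T" for c
    proof -
      obtain x where x: "x \<in> T" "c = ?fib x"
        using c by blast
      have "c = (\<lambda>h. h \<otimes> x) ` (T \<inter> H)"
      proof (intro equalityI subsetI)
        fix y assume "y \<in> c"
        then obtain h where h: "h \<in> H" "y = h \<otimes> x" "y \<in> T"
          using x by (auto simp: r_coset_def)
        then have "h = y \<otimes> inv x"
          using x TG subset by (auto simp: m_assoc subset_iff)
        then have "h \<in> T"
          by (simp add: h(3) x(1) subgroup.m_closed[OF T] subgroup.m_inv_closed[OF T])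
        with h show "y \<in> (\<lambda>h. h \<otimes> x) ` (T \<inter> H)" by blast
      qed (use x T in \<open>auto simp: r_coset_def intro: subgroup.m_closed\<close>)
      moreover have "inj_on (\<lambda>h. h \<otimes> x) (T \<inter> H)"
        using x TG by (auto simp: inj_on_def subset_iff)
      ultimately show ?thesis
        by (simp add: card_image)
    qed
    show "c1 \<inter> c2 = {}" if c: "c1 \<in> ?fib ` T" "c2 \<in> ?fib ` T" "c1 \<noteq> c2" for c1 c2
    proof -
      obtain x y where xy: "x \<in> T" "c1 = ?fib x" "y \<in> T" "c2 = ?fib y"
        using c by blast
      have "H #> z = H #> x \<and> H #> z = H #> y" if "z \<in> c1 \<inter> c2" for z
        using that xy TG repr_independence[OF _ _ is_subgroup] by blast
      with c xy show ?thesis by blast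
    qed
  qed
  then show ?thesis
    unfolding union card_fib .
qed

section \<open>Trajectories and entropy of a single endomorphism\<close>

locale group_endo = group G for G (structure) +
  fixes \<phi> :: "'a \<Rightarrow> 'a"
  assumes endo: "\<phi> \<in> hom G G"
begin

lemma funpow_endo: "\<phi> ^^ n \<in> hom G G"
proof (induction n)
  case 0
  then show ?case by (simp add: hom_def)
next
  case (Suc n)
  then show ?case
    using Group.hom_compose[OF _ endo] by (simp add: comp_def)
qed

sublocale pow: group_hom G G "\<phi> ^^ n" for n
  by unfold_locales (rule funpow_endo)

lemma trajectory_subset: "X \<subseteq> carrier G \<Longrightarrow> trajectory G \<phi> X n \<subseteq> carrier G"
proof (induction n)
  case (Suc n)
  then have "(\<phi> ^^ n) ` X \<subseteq> carrier G" by auto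
  with Suc show ?case by (simp add: setmult_subset_G)
qed simp

lemma finite_trajectory: "finite X \<Longrightarrow> finite (trajectory G \<phi> X n)"
  by (induction n) (auto intro: finite_set_mult)

lemma trajectory_nonempty: "X \<noteq> {} \<Longrightarrow> trajectory G \<phi> X n \<noteq> {}"
  by (induction n) (auto simp: set_mult_def)

lemma trajectory_mono: "X \<subseteq> Y \<Longrightarrow> trajectory G \<phi> X n \<subseteq> trajectory G \<phi> Y n"
  by (induction n) (simp_all add: mono_set_mult image_mono)

lemma trajectory_add:
  assumes X: "X \<subseteq> carrier G"
  shows "trajectory G \<phi> X (m + n) = trajectory G \<phi> X m <#> (\<phi> ^^ m) ` trajectory G \<phi> X n"
proof (induction n)
  case 0
  then show ?case
    using trajectory_subset[OF X, of m] by (force simp: set_mult_def)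
next
  case (Suc n)
  have im: "(\<phi> ^^ k) ` Y \<subseteq> carrier G" if "Y \<subseteq> carrier G" for k Y
    using that by auto
  have "(\<phi> ^^ (m + n)) ` X = (\<phi> ^^ m) ` (\<phi> ^^ n) ` X"
    by (simp add: funpow_add image_comp)
  then show ?case
    using trajectory_subset[OF X]
    by (simp add: Suc set_mult_assoc im X set_mult_hom[OF funpow_endo])
qed

text \<open>The definition adds new factors on the right. Splitting off the first factor instead
  leaves the image of a shorter trajectory, as the induction for permutable subgroups
  requires.\<close>

lemma trajectory_Suc_left:
  assumes "X \<subseteq> carrier G"
  shows "trajectory G \<phi> X (Suc n) = X <#> \<phi> ` trajectory G \<phi> X n"
proof -
  have "trajectory G \<phi> X (Suc 0) = X"
    using assms by (force simp: set_mult_def)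
  with trajectory_add[OF assms, of "Suc 0" n] show ?thesis by simp
qed

lemma one_in_trajectory: "\<one> \<in> X \<Longrightarrow> \<one> \<in> trajectory G \<phi> X n"
proof (induction n)
  case (Suc n)
  then have "\<one> \<otimes> (\<phi> ^^ n) \<one> \<in> trajectory G \<phi> X (Suc n)"
    unfolding trajectory.simps by (intro set_multI imageI) auto
  then show ?case by simp
qed simp

text \<open>The missing factors are filled with \<open>\<one>\<close>, on the right in the first
  case and on the left in the second.\<close>

lemma trajectory_subset_add:
  assumes "X \<subseteq> carrier G" "\<one> \<in> X"
  shows "trajectory G \<phi> X m \<subseteq> trajectory G \<phi> X (m + n)"
    and "(\<phi> ^^ m) ` trajectory G \<phi> X n \<subseteq> trajectory G \<phi> X (m + n)"
proof -
  note sub = trajectory_subset[OF assms(1)]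
  have "x \<otimes> (\<phi> ^^ m) \<one> \<in> trajectory G \<phi> X (m + n)" if "x \<in> trajectory G \<phi> X m" for x
    unfolding trajectory_add[OF assms(1)]
    using that by (intro set_multI imageI one_in_trajectory assms)
  then show "trajectory G \<phi> X m \<subseteq> trajectory G \<phi> X (m + n)"
    using sub[of m] by (force simp: subset_iff)
  have "\<one> \<otimes> (\<phi> ^^ m) x \<in> trajectory G \<phi> X (m + n)" if "x \<in> trajectory G \<phi> X n" for x
    unfolding trajectory_add[OF assms(1)]
    using that by (intro set_multI imageI one_in_trajectory assms)
  then show "(\<phi> ^^ m) ` trajectory G \<phi> X n \<subseteq> trajectory G \<phi> X (m + n)"
    using sub[of n] by (force simp: subset_iff)
qed

lemma card_trajectory_pos: "X \<in> finite_nonempty_subsets G \<Longrightarrow> 0 < card (trajectory G \<phi> X n)"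
  by (simp add: finite_nonempty_subsets_def card_gt_0_iff finite_trajectory trajectory_nonempty)

text \<open>\<open>lim\<close> is informative only for convergent sequences. Convergence holds
  because \<open>trajectory_add\<close> makes the logarithms subadditive: a homomorphic image is no
  larger than the original set.\<close>

lemma entropy_wrt_LIMSEQ:
  assumes X: "X \<in> finite_nonempty_subsets G"
  shows "(\<lambda>n. ln (real (card (trajectory G \<phi> X n))) / real n) \<longlonglongrightarrow> entropy_wrt G \<phi> X"
proof -
  let ?a = "\<lambda>n. ln (real (card (trajectory G \<phi> X n)))"
  note pos = card_trajectory_pos[OF X]
  have XG: "X \<subseteq> carrier G" "finite X"
    using X by (auto simp: finite_nonempty_subsets_def)
  have "convergent (\<lambda>n. ?a n / real n)"
  proof (rule fekete)
    show "0 \<le> ?a n" for n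
      using pos[of n] by (intro ln_ge_zero) linarith
    show "?a (m + n) \<le> ?a m + ?a n" for m n
    proof -
      have "card (trajectory G \<phi> X (m + n))
          \<le> card (trajectory G \<phi> X m) * card ((\<phi> ^^ m) ` trajectory G \<phi> X n)"
        unfolding trajectory_add[OF XG(1)]
        by (intro card_set_mult_le finite_imageI finite_trajectory XG)
      also have "\<dots> \<le> card (trajectory G \<phi> X m) * card (trajectory G \<phi> X n)"
        by (intro mult_left_mono card_image_le finite_trajectory XG) simp
      finally have "?a (m + n)
          \<le> ln (real (card (trajectory G \<phi> X m)) * real (card (trajectory G \<phi> X n)))"
        using pos by (subst ln_le_cancel_iff) (auto simp flip: of_nat_mult)
      then show ?thesis
        using pos[of m] pos[of n] by (simp add: ln_mult)
    qed
  qed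
  then show ?thesis
    unfolding entropy_wrt_def by (simp add: convergent_LIMSEQ_iff)
qed

lemma entropy_wrt_mono:
  assumes "X \<in> finite_nonempty_subsets G" "Y \<in> finite_nonempty_subsets G" "X \<subseteq> Y"
  shows "entropy_wrt G \<phi> X \<le> entropy_wrt G \<phi> Y"
proof (rule LIMSEQ_le[OF entropy_wrt_LIMSEQ entropy_wrt_LIMSEQ]; (intro exI allI impI)?)
  fix n
  have "card (trajectory G \<phi> X n) \<le> card (trajectory G \<phi> Y n)"
    using assms by (intro card_mono finite_trajectory trajectory_mono)
      (auto simp: finite_nonempty_subsets_def)
  then show "ln (real (card (trajectory G \<phi> X n))) / real n
      \<le> ln (real (card (trajectory G \<phi> Y n))) / real n"
    using card_trajectory_pos[OF assms(1), of n]
    by (intro divide_right_mono) auto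
qed (use assms in auto)

lemma entropy_wrt_le_algebraic_entropy:
  "X \<in> finite_nonempty_subsets G \<Longrightarrow> ereal (entropy_wrt G \<phi> X) \<le> algebraic_entropy G \<phi>"
  unfolding algebraic_entropy_def by (rule SUP_upper)

lemma one_finite_nonempty: "{\<one>} \<in> finite_nonempty_subsets G"
  by (simp add: finite_nonempty_subsets_def)

text \<open>By induction the image of the previous trajectory under \<phi> is a finite subgroup, so
  \<open>F\<close> commutes with it. Only \<open>F\<close> itself has to be permutable, not its
  images under powers of \<phi>.\<close>

lemma finite_subgroup_trajectory:
  assumes F: "F \<in> permutable_finite_subgroups G"
  shows "subgroup (trajectory G \<phi> F n) G"
proof (induction n)
  case 0
  then show ?case by (simp add: triv_subgroup)
next
  case (Suc n)
  have FG: "subgroup F G" "finite F"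
    and comm: "\<And>E. subgroup E G \<Longrightarrow> finite E \<Longrightarrow> F <#> E = E <#> F"
    using F by (auto simp: permutable_finite_subgroups_def finite_subgroups_def)
  have im: "subgroup (\<phi> ` trajectory G \<phi> F n) G"
    using pow.subgroup_img_is_subgroup[OF Suc, of 1] by simp
  have "subgroup (F <#> \<phi> ` trajectory G \<phi> F n) G"
    by (intro subgroup_set_mult_commute FG im comm finite_imageI finite_trajectory)
  then show ?case
    using trajectory_Suc_left[OF subgroup.subset[OF FG(1)]] by simp
qed

end

section \<open>Restriction to an invariant normal subgroup and passage to the quotient\<close>

locale normal_endo = group_endo G \<phi> + normal H G for G (structure) and \<phi> H +
  assumes invariant: "\<phi> ` H \<subseteq> H"
begin

abbreviation "GH \<equiv> G\<lparr>carrier := H\<rparr>"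
abbreviation "\<phi>H \<equiv> restrict \<phi> H"
abbreviation "\<phi>Q \<equiv> induced_endo G H \<phi>"
abbreviation "cosets X \<equiv> (\<lambda>x. H #> x) ` X"

lemma funpow_invariant: "h \<in> H \<Longrightarrow> (\<phi> ^^ n) h \<in> H"
  using invariant by (induction n) auto

sublocale sub: group_endo GH \<phi>H
proof -
  interpret GH: group GH
    by (rule subgroup_imp_group) (rule is_subgroup)
  show "group_endo GH \<phi>H"
    using invariant endo subset
    by unfold_locales (auto simp: hom_def subset_iff)
qed

sublocale quot: group_endo "G Mod H" \<phi>Q
proof -
  interpret Q: group "G Mod H"
    by (rule factorgroup_is_group)
  show "group_endo (G Mod H) \<phi>Q"
    by unfold_locales (rule induced_endo_hom[OF normal_axioms endo invariant])
qed

text \<open>\<open>restrict\<close> is \<open>undefined\<close> outside \<open>H\<close>, so the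
  iterates can be compared on \<open>H\<close> only; invariance keeps every iterate there.\<close>

lemma trajectory_restrict:
  assumes "X \<subseteq> H"
  shows "trajectory GH \<phi>H X n = trajectory G \<phi> X n"
proof -
  have "(\<phi>H ^^ n) x = (\<phi> ^^ n) x" if "x \<in> H" for n x
    by (induction n) (use that funpow_invariant in auto)
  then have "(\<phi>H ^^ n) ` X = (\<phi> ^^ n) ` X" for n
    using assms by (intro image_cong) auto
  then show ?thesis by (induction n) auto
qed

text \<open>The projection onto cosets is a homomorphism that intertwines \<phi> with the induced
  map.\<close>

lemma trajectory_cosets:
  assumes X: "X \<subseteq> carrier G"
  shows "trajectory (G Mod H) \<phi>Q (cosets X) n = cosets (trajectory G \<phi> X n)"
proof -
  have "(\<phi>Q ^^ n) (H #> x) = H #> (\<phi> ^^ n) x" if "x \<in> carrier G" for n x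
    by (induction n)
      (use that in \<open>auto simp: induced_endo_coset[OF normal_axioms endo invariant]\<close>)
  then have pow: "(\<phi>Q ^^ n) ` cosets X = cosets ((\<phi> ^^ n) ` X)" for n
    unfolding image_image using X by (intro image_cong) auto
  show ?thesis
  proof (induction n)
    case 0
    then show ?case using subset by (simp add: FactGroup_def)
  next
    case (Suc n)
    have "(\<phi> ^^ n) ` X \<subseteq> carrier G"
      using X by auto
    then show ?case
      by (simp add: Suc.IH pow set_mult_hom[OF r_coset_hom_Mod trajectory_subset[OF X]])
  qed
qed

text \<open>The condition \<open>\<exists>s\<in>T\<^sub>n. s \<phi>\<^sup>n(f) \<in> H\<close> says that \<open>\<phi>\<^sup>n(f) \<in> T\<^sub>n H\<close>; it is stable in \<open>n\<close> because
  \<open>\<phi>(T\<^sub>n) \<subseteq> T\<^sub>n\<^sub>+\<^sub>1\<close>.\<close>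

lemma trajectory_Int_subset:
  assumes F: "finite F" "F \<subseteq> carrier G" "\<one> \<in> F"
    and T: "\<And>n. subgroup (trajectory G \<phi> F n) G"
  obtains m where "\<And>k. trajectory G \<phi> F (m + k) \<inter> H
    \<subseteq> (trajectory G \<phi> F m \<inter> H) <#> trajectory G \<phi> (trajectory G \<phi> F (Suc m) \<inter> H) k"
proof -
  let ?T = "trajectory G \<phi> F"
  define P where "P n = {f \<in> F. \<exists>s\<in>?T n. s \<otimes> (\<phi> ^^ n) f \<in> H}" for n
  have carr: "x \<in> carrier G" if "x \<in> ?T n" for x n
    using that by (rule subgroup.mem_carrier[OF T])
  have P_mono: "f \<in> P (k + n)" if f: "f \<in> P n" for f n k
  proof -
    obtain s where s: "f \<in> F" "s \<in> ?T n" "s \<otimes> (\<phi> ^^ n) f \<in> H"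
      using f by (auto simp: P_def)
    have "(\<phi> ^^ k) s \<otimes> (\<phi> ^^ (k + n)) f = (\<phi> ^^ k) (s \<otimes> (\<phi> ^^ n) f)"
      using s F carr[OF s(2)] by (auto simp: funpow_add subset_iff)
    then have "(\<phi> ^^ k) s \<otimes> (\<phi> ^^ (k + n)) f \<in> H"
      using funpow_invariant[OF s(3)] by simp
    moreover have "(\<phi> ^^ k) s \<in> ?T (k + n)"
      using trajectory_subset_add(2)[OF F(2,3)] s by blast
    ultimately show ?thesis
      using s unfolding P_def by blast
  qed
  let ?U = "{f \<in> F. \<exists>n. f \<in> P n}"
  obtain N where N: "f \<in> P (N f)" if "f \<in> ?U" for f
    using bchoice[of ?U "\<lambda>f n. f \<in> P n"] by blast
  \<comment> \<open>Each \<open>f\<close> that ever satisfies the condition does so at stage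
    \<open>N f\<close>, hence at all later stages. As \<open>F\<close> is finite, one stage
    \<open>m\<close> serves all of them.\<close>
  define m where "m = Max (N ` ?U)"
  have m: "f \<in> P m" if f: "f \<in> P n" for f n
  proof -
    have U: "f \<in> ?U"
      using f by (auto simp: P_def)
    then have "N f \<le> m"
      unfolding m_def using F(1) by (intro Max_ge) auto
    then show ?thesis
      using P_mono[OF N[OF U], of "m - N f"] by simp
  qed
  let ?D = "\<lambda>n. ?T n \<inter> H"
  have step: "?D (Suc (m + k)) \<subseteq> ?D (m + k) <#> (\<phi> ^^ k) ` ?D (Suc m)" for k
  proof
    fix x assume x: "x \<in> ?D (Suc (m + k))"
    then obtain t f where tf: "t \<in> ?T (m + k)" "f \<in> F" "x = t \<otimes> (\<phi> ^^ (m + k)) f"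
      by (auto elim!: set_multE)
    with x have "f \<in> P (m + k)"
      unfolding P_def by blast
    then obtain s where s: "s \<in> ?T m" "s \<otimes> (\<phi> ^^ m) f \<in> H"
      using m unfolding P_def by blast
    define h where "h = s \<otimes> (\<phi> ^^ m) f"
    have h: "h \<in> ?D (Suc m)"
      using s tf by (auto simp: h_def intro: set_multI)
    \<comment> \<open>Chosen so that \<open>x\<close> is \<open>u\<close> times
      \<open>(\<phi> ^^ k) h\<close>. It lies in the trajectory because that is a subgroup
      containing \<open>t\<close> and \<open>(\<phi> ^^ k) s\<close>, and in \<open>H\<close>
      because \<open>x\<close> and \<open>(\<phi> ^^ k) h\<close> do.\<close>
    define u where "u = t \<otimes> inv ((\<phi> ^^ k) s)"
    have cl: "t \<in> carrier G" "s \<in> carrier G" "f \<in> carrier G" "h \<in> carrier G"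
      using carr tf s F h by auto
    then have fk: "(\<phi> ^^ k) t \<in> carrier G" "(\<phi> ^^ k) s \<in> carrier G" "(\<phi> ^^ k) h \<in> carrier G"
      "(\<phi> ^^ k) ((\<phi> ^^ m) f) \<in> carrier G"
      by auto
    have hk: "(\<phi> ^^ k) h = (\<phi> ^^ k) s \<otimes> (\<phi> ^^ (m + k)) f"
      using cl by (simp add: h_def funpow_add add.commute[of m k])
    have xk: "(\<phi> ^^ (m + k)) f = (\<phi> ^^ k) ((\<phi> ^^ m) f)"
      by (simp add: funpow_add add.commute[of m k])
    have x_eq: "x = u \<otimes> (\<phi> ^^ k) h"
      unfolding hk tf(3) u_def xk using cl fk by (simp add: m_assoc inv_solve_left)
    have "(\<phi> ^^ k) s \<in> ?T (m + k)"
      using trajectory_subset_add(2)[OF F(2,3), of k m] s by (auto simp: add.commute)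
    then have uT: "u \<in> ?T (m + k)"
      unfolding u_def using tf T by (intro subgroup.m_closed subgroup.m_inv_closed) auto
    have "u = x \<otimes> inv ((\<phi> ^^ k) h)"
      using carr[OF uT] fk by (simp add: x_eq m_assoc)
    moreover have "(\<phi> ^^ k) h \<in> H"
      using h funpow_invariant by blast
    ultimately have "u \<in> H"
      using x by auto
    with uT h show "x \<in> ?D (m + k) <#> (\<phi> ^^ k) ` ?D (Suc m)"
      unfolding x_eq by (intro set_multI imageI) auto
  qed
  have DG: "?D n \<subseteq> carrier G" for n
    using subset by auto
  have "?D (m + k) \<subseteq> ?D m <#> trajectory G \<phi> (?D (Suc m)) k" for k
  proof (induction k)
    case 0
    show ?case
      using DG[of m] by (force simp: set_mult_def)
  next
    case (Suc k)
    have "?D (m + Suc k) \<subseteq> ?D (m + k) <#> (\<phi> ^^ k) ` ?D (Suc m)"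
      using step by simp
    also have "\<dots> \<subseteq> (?D m <#> trajectory G \<phi> (?D (Suc m)) k) <#> (\<phi> ^^ k) ` ?D (Suc m)"
      by (intro mono_set_mult Suc order_refl)
    also have "\<dots> = ?D m <#> trajectory G \<phi> (?D (Suc m)) (Suc k)"
      unfolding trajectory.simps(2)[of G \<phi> "?D (Suc m)" k]
    proof (rule set_mult_assoc)
      show "(\<phi> ^^ k) ` ?D (Suc m) \<subseteq> carrier G"
        using DG[of "Suc m"] by auto
    qed (rule DG trajectory_subset)+
    finally show ?case .
  qed
  then show ?thesis by (rule that)
qed

lemma cosets_finite_nonempty:
  "X \<in> finite_nonempty_subsets G \<Longrightarrow> cosets X \<in> finite_nonempty_subsets (G Mod H)"
  by (auto simp: finite_nonempty_subsets_def FactGroup_def RCOSETS_def)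

text \<open>The number \<open>d\<close> below is the growth rate of the sets \<open>T\<^sub>n \<inter> H\<close>.\<close>

lemma entropy_wrt_permutable:
  assumes F: "F \<in> permutable_finite_subgroups G"
  obtains d where "entropy_wrt G \<phi> F = d + entropy_wrt (G Mod H) \<phi>Q (cosets F)"
    and "\<And>X. X \<in> finite_nonempty_subsets GH \<Longrightarrow> X \<subseteq> F \<Longrightarrow> entropy_wrt GH \<phi>H X \<le> d"
    and "ereal d \<le> algebraic_entropy GH \<phi>H"
proof -
  let ?T = "trajectory G \<phi> F"
  let ?D = "\<lambda>n. ?T n \<inter> H"
  have FG: "subgroup F G" "finite F" "F \<subseteq> carrier G" "\<one> \<in> F"
    using F by (auto simp: permutable_finite_subgroups_def finite_subgroups_def
        subgroup.subset subgroup.one_closed)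
  then have FF: "F \<in> finite_nonempty_subsets G"
    by (auto simp: finite_nonempty_subsets_def)
  note T = finite_subgroup_trajectory[OF F]
  note finT = finite_trajectory[OF FG(2)]
  have oneD: "\<one> \<in> ?D n" for n
    using one_in_trajectory[OF FG(4)] by simp
  have DH: "?D n \<in> finite_nonempty_subsets GH" for n
    using finT oneD[of n] by (auto simp: finite_nonempty_subsets_def)
  have posD: "0 < card (?D n)" for n
    using finT oneD by (metis card_gt_0_iff empty_iff finite_Int)
  let ?d = "\<lambda>n. ln (real (card (?D n)))"
  let ?b = "\<lambda>n. ln (real (card (trajectory (G Mod H) \<phi>Q (cosets F) n)))"
  \<comment> \<open>As a difference of two existing limits, \<open>d\<close> yields the required
    equation at once, and \<open>split\<close> identifies it as the limit of
    \<open>?d n / real n\<close>.\<close>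
  define d where "d = entropy_wrt G \<phi> F - entropy_wrt (G Mod H) \<phi>Q (cosets F)"
  have split: "?d n = ln (real (card (?T n))) - ?b n" for n
  proof -
    have "card (?T n) = card (?D n) * card (trajectory (G Mod H) \<phi>Q (cosets F) n)"
      unfolding trajectory_cosets[OF FG(3)] by (rule card_Int_mult_card_cosets[OF T finT, symmetric])
    then show ?thesis
      using posD[of n] quot.card_trajectory_pos[OF cosets_finite_nonempty[OF FF], of n]
      by (simp add: ln_mult)
  qed
  have lim: "(\<lambda>n. ?d n / real n) \<longlonglongrightarrow> d"
    unfolding d_def split diff_divide_distrib
    by (intro tendsto_diff entropy_wrt_LIMSEQ quot.entropy_wrt_LIMSEQ cosets_finite_nonempty FF)
  show ?thesis
  proof
    show "entropy_wrt G \<phi> F = d + entropy_wrt (G Mod H) \<phi>Q (cosets F)"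
      by (simp add: d_def)
  next
    fix X assume X: "X \<in> finite_nonempty_subsets GH" "X \<subseteq> F"
    then have XH: "X \<subseteq> H"
      by (simp add: finite_nonempty_subsets_def)
    have "trajectory GH \<phi>H X n \<subseteq> ?D n" for n
      using sub.trajectory_subset[of X n] trajectory_mono[OF X(2), of n] XH
      by (simp add: trajectory_restrict)
    then have "card (trajectory GH \<phi>H X n) \<le> card (?D n)" for n
      using finT by (intro card_mono) auto
    then have "ln (real (card (trajectory GH \<phi>H X n))) / real n \<le> ?d n / real n" for n
      using sub.card_trajectory_pos[OF X(1)] posD by (intro divide_right_mono) simp_all
    then show "entropy_wrt GH \<phi>H X \<le> d"
      by (intro LIMSEQ_le[OF sub.entropy_wrt_LIMSEQ[OF X(1)] lim]) blast
  next
    obtain m where m: "\<And>k. ?D (m + k) \<subseteq> ?D m <#> trajectory G \<phi> (?D (Suc m)) k"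
      using trajectory_Int_subset[OF FG(2-4) T] by blast
    define E where "E = ?D (Suc m)"
    have DHE: "E \<in> finite_nonempty_subsets GH" and oneE: "\<one> \<in> E"
      unfolding E_def by (rule DH oneD)+
    then have EG: "E \<subseteq> carrier G" "finite E" "E \<subseteq> H"
      using subset by (auto simp: finite_nonempty_subsets_def)
    let ?e = "\<lambda>n. ln (real (card (trajectory GH \<phi>H E n)))"
    \<comment> \<open>The \<open>k\<close>-th trajectory of \<open>E\<close> is enlarged to the
      \<open>n\<close>-th, which is possible since \<open>\<one> \<in> E\<close>. Both sides then
      have denominator \<open>n\<close>, and the fixed term \<open>?d m\<close> vanishes in the
      limit.\<close>
    have bound: "?d n / real n \<le> ?d m / real n + ?e n / real n" if n: "n \<ge> m" for n
    proof -
      obtain k where k: "n = m + k"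
        using n le_Suc_ex by blast
      have "?D n \<subseteq> ?D m <#> trajectory G \<phi> E k"
        using m k unfolding E_def by blast
      also have "\<dots> \<subseteq> ?D m <#> trajectory G \<phi> E n"
        using trajectory_subset_add(1)[OF EG(1) oneE, of k m] unfolding k
        by (intro mono_set_mult) (simp_all add: add.commute)
      finally have "card (?D n) \<le> card (?D m <#> trajectory G \<phi> E n)"
        using finT finite_trajectory[OF EG(2)] by (intro card_mono finite_set_mult) auto
      also have "\<dots> \<le> card (?D m) * card (trajectory GH \<phi>H E n)"
        using finT finite_trajectory[OF EG(2)]
        unfolding trajectory_restrict[OF EG(3)] by (intro card_set_mult_le) auto
      finally have "?d n \<le> ln (real (card (?D m)) * real (card (trajectory GH \<phi>H E n)))"
        using posD[of n] posD[of m] sub.card_trajectory_pos[OF DHE]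
        by (subst ln_le_cancel_iff) (auto simp flip: of_nat_mult)
      also have "\<dots> = ?d m + ?e n"
        using posD[of m] sub.card_trajectory_pos[OF DHE, of n] by (simp add: ln_mult)
      finally show ?thesis
        by (simp add: divide_right_mono flip: add_divide_distrib)
    qed
    have "(\<lambda>n. ?d m / real n + ?e n / real n) \<longlonglongrightarrow> 0 + entropy_wrt GH \<phi>H E"
      by (intro tendsto_add lim_const_over_n sub.entropy_wrt_LIMSEQ DHE)
    from LIMSEQ_le[OF lim this] bound have "d \<le> entropy_wrt GH \<phi>H E"
      by auto
    then show "ereal d \<le> algebraic_entropy GH \<phi>H"
      using sub.entropy_wrt_le_algebraic_entropy[OF DHE] order_trans ereal_less_eq(3) by blast
  qed
qed

end

section \<open>From permutable finite subgroups to suprema over all finite sets\<close>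

theorem theorem1p4:
  fixes G :: "('a, 'b) monoid_scheme" and \<phi> :: "'a \<Rightarrow> 'a" and H :: "'a set"
  assumes "group G"
    and "finitely_quasihamiltonian G"
    and "locally_finite_group G"
    and "\<phi> \<in> hom G G"
    and "H \<lhd> G"
    and "\<phi> ` H \<subseteq> H"
  shows "algebraic_entropy G \<phi> =
    algebraic_entropy (G\<lparr>carrier := H\<rparr>) (restrict \<phi> H) +
    algebraic_entropy (G Mod H) (induced_endo G H \<phi>)"
proof -
  interpret normal_endo G \<phi> H
    using assms by (simp add: normal_endo_def normal_endo_axioms_def group_endo_def group_endo_axioms_def)
  \<comment> \<open>Local finiteness makes the subgroup generated by \<open>X\<close> finite;
    quasihamiltonicity then encloses it in a permutable one.\<close>
  have cofinal: "\<exists>F \<in> permutable_finite_subgroups G. X \<subseteq> F" if "X \<subseteq> carrier G" "finite X" for X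
  proof -
    have "generate G X \<in> finite_subgroups G"
      using that assms(3) generate_is_subgroup
      by (auto simp: finite_subgroups_def locally_finite_group_def)
    then obtain F where "F \<in> permutable_finite_subgroups G" "generate G X \<subseteq> F"
      using assms(2) by (auto simp: finitely_quasihamiltonian_def)
    then show ?thesis
      by (meson generate.incl subset_iff)
  qed
  have fin_sub: "F \<in> finite_nonempty_subsets G" if "F \<in> permutable_finite_subgroups G" for F
    using that subgroup.subset subgroup.one_closed
    by (fastforce simp: permutable_finite_subgroups_def finite_subgroups_def finite_nonempty_subsets_def)
  let ?HQ = "entropy_wrt (G Mod H) \<phi>Q"
  show ?thesis
  proof (rule antisym)
    show "algebraic_entropy G \<phi> \<le> algebraic_entropy GH \<phi>H + algebraic_entropy (G Mod H) \<phi>Q"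
      unfolding algebraic_entropy_def[of G \<phi>]
    proof (rule SUP_least)
      fix X assume X: "X \<in> finite_nonempty_subsets G"
      then obtain F where F: "F \<in> permutable_finite_subgroups G" "X \<subseteq> F"
        using cofinal unfolding finite_nonempty_subsets_def by blast
      obtain d where d: "entropy_wrt G \<phi> F = d + ?HQ (cosets F)"
        "ereal d \<le> algebraic_entropy GH \<phi>H"
        using entropy_wrt_permutable[OF F(1)] by metis
      have "ereal (entropy_wrt G \<phi> X) \<le> ereal d + ereal (?HQ (cosets F))"
        using entropy_wrt_mono[OF X fin_sub[OF F(1)] F(2)] d by simp
      also have "\<dots> \<le> algebraic_entropy GH \<phi>H + algebraic_entropy (G Mod H) \<phi>Q"
        by (intro add_mono d quot.entropy_wrt_le_algebraic_entropy cosets_finite_nonempty fin_sub F)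
      finally show "ereal (entropy_wrt G \<phi> X)
        \<le> algebraic_entropy GH \<phi>H + algebraic_entropy (G Mod H) \<phi>Q" .
    qed
  next
    \<comment> \<open>A single \<open>F\<close> is taken large enough to contain both
      \<open>X\<close> and a finite set \<open>R\<close> of representatives for \<open>Y\<close>, so
      that one splitting of its entropy bounds both summands.\<close>
    have bound: "ereal (entropy_wrt GH \<phi>H X) + ereal (?HQ Y) \<le> algebraic_entropy G \<phi>"
      if X: "X \<in> finite_nonempty_subsets GH" and Y: "Y \<in> finite_nonempty_subsets (G Mod H)" for X Y
    proof -
      have "finite Y" "Y \<subseteq> cosets (carrier G)"
        using Y by (auto simp: finite_nonempty_subsets_def FactGroup_def RCOSETS_def)
      then obtain R where R: "R \<subseteq> carrier G" "finite R" "Y = cosets R"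
        by (meson finite_subset_image)
      have "X \<union> R \<subseteq> carrier G" "finite (X \<union> R)"
        using X R subset by (auto simp: finite_nonempty_subsets_def)
      from cofinal[OF this] obtain F where F: "F \<in> permutable_finite_subgroups G" "X \<union> R \<subseteq> F"
        by blast
      obtain d where d: "entropy_wrt G \<phi> F = d + ?HQ (cosets F)" "entropy_wrt GH \<phi>H X \<le> d"
        using entropy_wrt_permutable[OF F(1)] X F(2) by (metis le_sup_iff)
      have "?HQ Y \<le> ?HQ (cosets F)"
        using F R by (intro quot.entropy_wrt_mono Y cosets_finite_nonempty fin_sub) auto
      with d have "ereal (entropy_wrt GH \<phi>H X) + ereal (?HQ Y) \<le> ereal (entropy_wrt G \<phi> F)"
        by simp
      also have "\<dots> \<le> algebraic_entropy G \<phi>"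
        by (intro entropy_wrt_le_algebraic_entropy fin_sub F)
      finally show ?thesis .
    qed
    have ne: "finite_nonempty_subsets GH \<noteq> {}" "finite_nonempty_subsets (G Mod H) \<noteq> {}"
      using sub.one_finite_nonempty quot.one_finite_nonempty by blast+
    obtain X where "X \<in> finite_nonempty_subsets GH"
      using ne by blast
    \<comment> \<open>Moving a constant summand out of a supremum in \<open>ereal\<close> needs a
      nonempty index set and a summand other than \<open>-\<infinity>\<close>. The inner summand is
      a real number; the outer one is this entropy.\<close>
    then have "algebraic_entropy GH \<phi>H \<noteq> -\<infinity>"
      using sub.entropy_wrt_le_algebraic_entropy by fastforce
    then have "algebraic_entropy GH \<phi>H + algebraic_entropy (G Mod H) \<phi>Q
        = (SUP Y\<in>finite_nonempty_subsets (G Mod H). SUP X\<in>finite_nonempty_subsets GH.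
            ereal (entropy_wrt GH \<phi>H X) + ereal (?HQ Y))"
      using ne unfolding algebraic_entropy_def
      by (simp add: SUP_ereal_add_left SUP_ereal_add_right del: plus_ereal.simps)
    also have "\<dots> \<le> algebraic_entropy G \<phi>"
      by (intro SUP_least bound)
    finally show "algebraic_entropy GH \<phi>H + algebraic_entropy (G Mod H) \<phi>Q \<le> algebraic_entropy G \<phi>" .
  qed
qed

end
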